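(* Let $k,n$ be integers with $0\le k\le n$. Then, for all complex $x$ with $|x|<\tfrac12$, $$Hl\left(\tfrac12,(2k+1)(k+n+1);\,2(k+n+1),\,2k+1;\,2k+1,\,2k+1;\,x\right)=4^k\binom{n+k}{n}^{-1}\binom{n}{k}^{-1}\sum_{j=0}^{n-k}\binom{2k+2j}{2j}\binom{n}{k+j}r_{nj}(1-2x)^{-2k-1-2j}$$ and $$Hl\left(\tfrac12,(2k+1)(k+n+1);\,2(k+n+1),\,2k+1;\,2k+1,\,2k+1;\,x\right)=(1-2x)^{-2n-1}\sum_{j=0}^{n-k}4^j\binom{n-k}{j}\frac{(k+1/2)_j}{(2k+1)_j}(x^2-x)^j.$$
   Context: Heun function: for $a\notin\{0,1\}$, $\gamma\notin\{0,-1,-2,\dots\}$ and $\epsilon$ defined by $\alpha+\beta+1=\gamma+\delta+\epsilon$, $Hl(a,q;\alpha,\beta;\gamma,\delta;x)$ denotes the (local) Heun function, i.e. the solution $u(x)$, analytic near $x=0$ and normalized by $u(0)=1$, of $$u''(x)+\left(\frac{\gamma}{x}+\frac{\delta}{x-1}+\frac{\epsilon}{x-a}\right)u'(x)+\frac{\alpha\beta x-q}{x(x-1)(x-a)}u(x)=0.$$ (For $a=\tfrac12$ its power series at $0$ converges for $|x|<\tfrac12$.) Notation: $(y)_0:=1$, $(y)_l:=y(y+1)\cdots(y+l-1)$ for $l\ge1$; for $0\le j\le n$, $r_{nj}:=\binom{n}{j}^{-1}4^{-n}\binom{2j}{j}\binom{2n-2j}{n-j}$. *)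

theory Defs
  imports "HOL-Analysis.Analysis"
begin

text \<open>
  The Heun equation is required on a punctured neighbourhood of 0 only: its coefficients have a
  pole at 0, where Isabelle's convention \<open>y / 0 = 0\<close> would give it an unintended meaning.
\<close>

definition heun_local_solution ::
  "complex \<Rightarrow> complex \<Rightarrow> complex \<Rightarrow> complex \<Rightarrow> complex \<Rightarrow> complex \<Rightarrow> (complex \<Rightarrow> complex) \<Rightarrow> bool"
where
  "heun_local_solution a q \<alpha> \<beta> \<gamma> \<delta> u \<longleftrightarrow>
     (let \<epsilon> = \<alpha> + \<beta> + 1 - \<gamma> - \<delta> in
       u analytic_on {0} \<and> u 0 = 1 \<and>
       (\<forall>\<^sub>F x in at 0.
          deriv (deriv u) x + (\<gamma> / x + \<delta> / (x - 1) + \<epsilon> / (x - a)) * deriv u x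
            + (\<alpha> * \<beta> * x - q) / (x * (x - 1) * (x - a)) * u x = 0))"

text \<open>
  A local solution is determined only as a germ at 0. The Heun function is the sum of the power
  series of this germ; its values are meaningful inside the disc of convergence, for
  \<open>a \<notin> {0, 1}\<close> and \<open>\<gamma> \<notin> {0, -1, -2, \<dots>}\<close>, which make the germ exist and be unique.
\<close>

definition Hl ::
  "complex \<Rightarrow> complex \<Rightarrow> complex \<Rightarrow> complex \<Rightarrow> complex \<Rightarrow> complex \<Rightarrow> complex \<Rightarrow> complex"
where
  "Hl a q \<alpha> \<beta> \<gamma> \<delta> =
     eval_fps (THE F. \<exists>u. heun_local_solution a q \<alpha> \<beta> \<gamma> \<delta> u \<and> u has_fps_expansion F)"

definition r_coeff :: "nat \<Rightarrow> nat \<Rightarrow> real" where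
  "r_coeff n j = inverse (real (n choose j)) * inverse (4 ^ n)
             * real ((2 * j) choose j) * real ((2 * n - 2 * j) choose (n - j))"

end

theory Submission
  imports Defs "HOL-Complex_Analysis.Laurent_Convergence"
begin

text \<open>
  The singular points 0 and 1 of the Heun equation carry equal parameters and lie symmetrically about
  \<open>a = 1/2\<close>; moreover \<open>q = \<alpha> \<beta> a\<close>, so \<open>x - a\<close> cancels in the coefficient of \<open>u\<close>. In the coordinate
  \<open>y = 1 - 2 x\<close> the equation is invariant under \<open>y \<mapsto> - y\<close>, hence is of hypergeometric type in \<open>y\<^sup>2\<close>.
  The right-hand sides of the theorem are its terminating hypergeometric solutions: one in powers of
  \<open>1 / y\<^sup>2\<close>, belonging to the exponent \<open>- 2 k - 1\<close> at \<open>y = \<infinity>\<close>, the other expanded about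
  \<open>x = 0\<close> in powers of \<open>1 - y\<^sup>2 = 4 x (1 - x)\<close> after splitting off the power \<open>y powi (- 2 n - 1)\<close>. In
  either expansion the differential operator maps each term to a combination of two neighbouring
  powers and the sum telescopes (\<open>inv_power_sum_solution\<close>, \<open>hyp_sum_solution\<close>).

  Since \<open>\<gamma> = 2 k + 1\<close> is not a non-positive integer, an analytic solution at \<open>x = 0\<close> is determined by
  its value there. So each sum equals the Heun function once its value at \<open>y = 1\<close> is 1
  (\<open>Hl_eq_local_solution\<close>, \<open>Hl_half_eqI\<close>). For the second sum this is the constant term. For the
  first it is a terminating hypergeometric series at 1, summed by the Chu-Vandermonde identity
  (\<open>sum_inv_coeff\<close>); its hypergeometric coefficients are matched with the binomial ones of the theorem
  by comparing quotients of consecutive terms (\<open>inv_binomial_coeff_eq\<close>).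
\<close>

section \<open>Uniqueness of the local Heun solution\<close>

text \<open>
  The Heun equation times \<open>x (x - 1) (x - a)\<close> has polynomial coefficients and so passes to the power
  series of a solution. It is known only for \<open>x \<noteq> 0\<close>; one more factor \<open>x\<close> makes it hold at 0 as
  well, and that factor cancels among formal power series.
\<close>

lemma heun_local_solution_fps:
  fixes a :: complex
  assumes sol: "heun_local_solution a q \<alpha> \<beta> \<gamma> \<delta> u" and F: "u has_fps_expansion F" and a: "a \<noteq> 0"
  defines "\<epsilon> \<equiv> \<alpha> + \<beta> + 1 - \<gamma> - \<delta>"
  shows "fps_X * (fps_X - 1) * (fps_X - fps_const a) * fps_deriv (fps_deriv F)
       + (fps_const \<gamma> * (fps_X - 1) * (fps_X - fps_const a)
          + fps_const \<delta> * fps_X * (fps_X - fps_const a)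
          + fps_const \<epsilon> * fps_X * (fps_X - 1)) * fps_deriv F
       + (fps_const (\<alpha> * \<beta>) * fps_X - fps_const q) * F = 0" (is "?H = 0")
proof -
  define E where "E x = x * (x - 1) * (x - a) * deriv (deriv u) x
       + (\<gamma> * (x - 1) * (x - a) + \<delta> * x * (x - a) + \<epsilon> * x * (x - 1)) * deriv u x
       + (\<alpha> * \<beta> * x - q) * u x" for x
  have "E has_fps_expansion ?H"
    unfolding E_def by (intro fps_expansion_intros F)
  then have exp: "(\<lambda>x. x * E x) has_fps_expansion fps_X * ?H"
    by (intro fps_expansion_intros)
  have ne: "\<forall>\<^sub>F x in at 0. x \<noteq> 0 \<and> x \<noteq> 1 \<and> x \<noteq> a"
    using a by (intro eventually_conj eventually_neq_at_within)
  have "\<forall>\<^sub>F x in at 0. deriv (deriv u) x + (\<gamma> / x + \<delta> / (x - 1) + \<epsilon> / (x - a)) * deriv u x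
            + (\<alpha> * \<beta> * x - q) / (x * (x - 1) * (x - a)) * u x = 0"
    using sol by (simp add: heun_local_solution_def Let_def \<epsilon>_def)
  with ne have "\<forall>\<^sub>F x in at 0. x * E x = 0"
  proof eventually_elim
    case (elim x)
    have "E x = x * (x - 1) * (x - a) * (deriv (deriv u) x
            + (\<gamma> / x + \<delta> / (x - 1) + \<epsilon> / (x - a)) * deriv u x
            + (\<alpha> * \<beta> * x - q) / (x * (x - 1) * (x - a)) * u x)"
      using elim(1) unfolding E_def by (simp add: divide_simps) (simp add: algebra_simps)
    then show ?case using elim(2) by simp
  qed
  then have "\<forall>\<^sub>F x in nhds 0. x * E x = 0"
    by (auto simp: eventually_at_filter elim: eventually_mono)
  then have "(\<lambda>x. x * E x) has_fps_expansion 0"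
    by (simp add: has_fps_expansion_0_iff)
  from fps_expansion_unique_complex[OF exp this] show ?thesis by simp
qed

text \<open>
  Frobenius' recurrence in homogeneous form: once the coefficients of index at most \<open>i\<close> vanish, the
  coefficient of \<open>X ^ i\<close> in the equation reduces to \<open>a (i + 1) (i + \<gamma>)\<close> times the coefficient of
  \<open>D\<close> of index \<open>i + 1\<close>, and the conditions on \<open>a\<close> and \<open>\<gamma>\<close> say that this factor is not 0.
\<close>

lemma heun_fps_eq_0:
  fixes D :: "complex fps"
  assumes a: "a \<noteq> 0" and \<gamma>: "\<And>i. \<gamma> \<noteq> - of_nat i" and D0: "fps_nth D 0 = 0"
    and eq: "fps_X * (fps_X - 1) * (fps_X - fps_const a) * fps_deriv (fps_deriv D)
       + (fps_const \<gamma> * (fps_X - 1) * (fps_X - fps_const a)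
          + fps_const \<delta> * fps_X * (fps_X - fps_const a)
          + fps_const \<epsilon> * fps_X * (fps_X - 1)) * fps_deriv D
       + (fps_const p * fps_X - fps_const q) * D = 0"
  shows "D = 0"
proof -
  let ?D1 = "fps_deriv D" and ?D2 = "fps_deriv (fps_deriv D)"
  have eq': "fps_X ^ 3 * ?D2 - fps_const (1 + a) * (fps_X ^ 2 * ?D2) + fps_const a * (fps_X ^ 1 * ?D2)
      + fps_const (\<gamma> + \<delta> + \<epsilon>) * (fps_X ^ 2 * ?D1)
      - fps_const (\<gamma> * (1 + a) + \<delta> * a + \<epsilon>) * (fps_X ^ 1 * ?D1)
      + fps_const (\<gamma> * a) * ?D1 + fps_const p * (fps_X ^ 1 * D) - fps_const q * D = 0"
    unfolding eq[symmetric]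
    by (simp add: fps_const_add[symmetric] fps_const_mult[symmetric] algebra_simps
          power2_eq_square power3_eq_cube del: fps_const_add fps_const_mult)
  have "fps_nth D m = 0" for m
  proof (induction m rule: less_induct)
    case (less m)
    show ?case
    proof (cases m)
      case 0
      then show ?thesis using D0 by simp
    next
      case (Suc i)
      have z: "fps_nth D j = 0" if "j \<le> i" for j
        using less.IH[of j] that Suc by simp
      have "fps_nth (fps_X ^ 3 * ?D2) i = 0" "fps_nth (fps_X ^ 2 * ?D2) i = 0"
        "fps_nth (fps_X ^ 2 * ?D1) i = 0" "fps_nth (fps_X ^ 1 * ?D1) i = 0"
        "fps_nth (fps_X ^ 1 * D) i = 0" "fps_nth D i = 0"
        "fps_nth (fps_X ^ 1 * ?D2) i = of_nat i * (of_nat i + 1) * fps_nth D (Suc i)"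
        "fps_nth ?D1 i = (of_nat i + 1) * fps_nth D (Suc i)"
        using z by (auto simp: fps_X_power_mult_nth simp del: power_Suc power_one_right)
      then have "a * (of_nat i * (of_nat i + 1) * fps_nth D (Suc i))
          + \<gamma> * a * ((of_nat i + 1) * fps_nth D (Suc i)) = 0"
        using arg_cong[OF eq', of "\<lambda>G. fps_nth G i"]
        by (simp only: fps_add_nth fps_sub_nth fps_mult_left_const_nth fps_zero_nth) simp
      then have "a * (of_nat i + 1) * (of_nat i + \<gamma>) * fps_nth D (Suc i) = 0"
        by (simp only: algebra_simps)
      moreover have "of_nat i + \<gamma> \<noteq> 0"
        using \<gamma>[of i] by (metis add.commute eq_neg_iff_add_eq_0)
      moreover have "of_nat i + 1 \<noteq> (0 :: complex)"
        by (metis of_nat_Suc add.commute of_nat_neq_0)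
      ultimately show ?thesis using a Suc by simp
    qed
  qed
  then show ?thesis by (simp add: fps_eq_iff)
qed

lemma heun_local_solution_fps_unique:
  assumes "heun_local_solution a q \<alpha> \<beta> \<gamma> \<delta> u" "u has_fps_expansion F"
    and "heun_local_solution a q \<alpha> \<beta> \<gamma> \<delta> v" "v has_fps_expansion G"
    and a: "a \<noteq> 0" and \<gamma>: "\<And>i. \<gamma> \<noteq> - of_nat i"
  shows "F = G"
proof -
  have "fps_nth F 0 = 1" "fps_nth G 0 = 1"
    using assms(1-4) by (simp_all add: fps_nth_fps_expansion heun_local_solution_def Let_def)
  then have "fps_nth (F - G) 0 = 0" by simp
  moreover have lin: "P * fps_deriv (fps_deriv (F - G)) + Q * fps_deriv (F - G) + R * (F - G) = 0"
    if "P * fps_deriv (fps_deriv F) + Q * fps_deriv F + R * F = 0"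
      and "P * fps_deriv (fps_deriv G) + Q * fps_deriv G + R * G = 0" for P Q R
    using arg_cong2[OF that, of "(-)"] by (simp add: algebra_simps)
  ultimately have "F - G = 0"
    using heun_fps_eq_0[OF a \<gamma> _ lin[OF heun_local_solution_fps[OF assms(1,2) a]
      heun_local_solution_fps[OF assms(3,4) a]]] by blast
  then show ?thesis by simp
qed

text \<open>
  This removes the definite description from the Heun function: any explicit local solution that is
  holomorphic on a disc around 0 computes it on the whole disc.
\<close>

lemma Hl_eq_local_solution:
  assumes sol: "heun_local_solution a q \<alpha> \<beta> \<gamma> \<delta> u" and hol: "u holomorphic_on ball 0 r"
    and x: "norm x < r" and a: "a \<noteq> 0" and \<gamma>: "\<And>i. \<gamma> \<noteq> - of_nat i"
  shows "Hl a q \<alpha> \<beta> \<gamma> \<delta> x = u x"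
proof -
  have "r > 0" using x norm_ge_zero[of x] by linarith
  then have F: "u has_fps_expansion fps_expansion u 0"
    using hol by (intro has_fps_expansion_fps_expansion[of "ball 0 r"]) auto
  have "(THE F. \<exists>u. heun_local_solution a q \<alpha> \<beta> \<gamma> \<delta> u \<and> u has_fps_expansion F) = fps_expansion u 0"
    using sol F by (intro the_equality) (blast intro: heun_local_solution_fps_unique[OF _ _ _ _ a \<gamma>])+
  then show ?thesis
    unfolding Hl_def using has_fps_expansion_imp_eval_fps_eq[OF F x hol] by simp
qed

section \<open>The equation centred at its singular point 1/2\<close>

text \<open>
  For \<open>a = 1 / 2\<close> and \<open>q = \<alpha> \<beta> / 2\<close> the factor \<open>x - a\<close> cancels in the last term of the Heun
  equation. With the parameters \<open>\<gamma> = \<delta> = \<beta> = 2 k + 1\<close>, \<open>\<alpha> = 2 (k + n + 1)\<close>, and hence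
  \<open>\<epsilon> = 2 n + 2\<close>, the substitution \<open>y = 1 - 2 x\<close> then leads to the equation below, which is invariant
  under \<open>y \<mapsto> - y\<close>. The arguments \<open>U\<close>, \<open>U1\<close>, \<open>U2\<close> stand for the values at \<open>y\<close> of a function and
  its first two derivatives.
\<close>

definition centred_heun_eq :: "nat \<Rightarrow> nat \<Rightarrow> complex \<Rightarrow> complex \<Rightarrow> complex \<Rightarrow> complex \<Rightarrow> bool" where
  "centred_heun_eq k n y U U1 U2 \<longleftrightarrow>
     y * (y^2 - 1) * U2 + (2 * (2 * of_nat k + 1) * y^2 + 2 * (of_nat n + 1) * (y^2 - 1)) * U1
       + 2 * (2 * of_nat k + 1) * (of_nat k + of_nat n + 1) * y * U = 0"

lemma centred_heun_eq_scale:
  "centred_heun_eq k n y U U1 U2 \<Longrightarrow> centred_heun_eq k n y (C * U) (C * U1) (C * U2)"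
  unfolding centred_heun_eq_def by (drule arg_cong[where f = "(*) C"]) (simp add: algebra_simps)

lemma of_nat_Suc_neq: "of_nat (m + 1) \<noteq> - (of_nat i :: complex)"
  unfolding eq_neg_iff_add_eq_0 of_nat_add[symmetric] of_nat_eq_0_iff by simp

lemma pochhammer_of_nat_Suc_neq_0: "pochhammer (of_nat (m + 1)) j \<noteq> (0 :: complex)"
  using of_nat_Suc_neq by (auto simp only: pochhammer_eq_0_iff)

text \<open>
  The disc \<open>|x| < 1 / 2\<close> is mapped by \<open>y = 1 - 2 x\<close> into the punctured plane \<open>y \<noteq> 0\<close>, so a solution
  in \<open>y\<close> that is regular away from 0 and has the value 1 at \<open>y = 1\<close> is the local solution at \<open>x = 0\<close>.
\<close>

lemma Hl_half_eqI:
  fixes U U1 U2 :: "complex \<Rightarrow> complex"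
  assumes d1: "\<And>y. y \<noteq> 0 \<Longrightarrow> (U has_field_derivative U1 y) (at y)"
    and d2: "\<And>y. y \<noteq> 0 \<Longrightarrow> (U1 has_field_derivative U2 y) (at y)"
    and eq: "\<And>y. y \<noteq> 0 \<Longrightarrow> centred_heun_eq k n y (U y) (U1 y) (U2 y)"
    and U1: "U 1 = 1" and x: "norm x < 1 / 2"
  shows "Hl (1 / 2) (of_nat ((2 * k + 1) * (k + n + 1)))
            (of_nat (2 * (k + n + 1))) (of_nat (2 * k + 1))
            (of_nat (2 * k + 1)) (of_nat (2 * k + 1)) x = U (1 - 2 * x)"
proof -
  define S where "S = ball (0 :: complex) (1 / 2)"
  have S: "open S" "0 \<in> S" unfolding S_def by auto
  have ne: "1 - 2 * z \<noteq> 0" if "z \<in> S" for z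
  proof
    assume "1 - 2 * z = 0"
    then have "z = 1 / 2" by (simp add: field_simps)
    then have "norm z = 1 / 2" by (simp only: norm_divide norm_one norm_numeral)
    then show False using that by (simp add: S_def)
  qed
  define u where "u z = U (1 - 2 * z)" for z
  have dy: "((\<lambda>z. 1 - 2 * z) has_field_derivative - 2) (at z)" for z :: complex
    by (auto intro!: derivative_eq_intros)
  have du: "(u has_field_derivative - 2 * U1 (1 - 2 * z)) (at z)" if "z \<in> S" for z
    unfolding u_def using DERIV_chain2[where f = U and g = "\<lambda>z. 1 - 2 * z", OF d1[OF ne[OF that]] dy]
    by (simp add: mult.commute)
  have du1: "((\<lambda>z. - 2 * U1 (1 - 2 * z)) has_field_derivative 4 * U2 (1 - 2 * z)) (at z)"
    if "z \<in> S" for z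
    using DERIV_cmult[OF DERIV_chain2[where f = U1 and g = "\<lambda>z. 1 - 2 * z", OF d2[OF ne[OF that]] dy],
      of "- 2"] by (simp add: mult.commute)
  have deriv1: "deriv u z = - 2 * U1 (1 - 2 * z)" if "z \<in> S" for z
    using du[OF that] by (rule DERIV_imp_deriv)
  have deriv2: "deriv (deriv u) z = 4 * U2 (1 - 2 * z)" if "z \<in> S" for z
  proof (rule DERIV_imp_deriv)
    show "(deriv u has_field_derivative 4 * U2 (1 - 2 * z)) (at z)"
      by (rule has_field_derivative_transform_within_open[OF du1[OF that] S(1) that])
        (simp add: deriv1)
  qed
  have hol: "u holomorphic_on S"
    using du by (intro holomorphic_onI) (auto simp: field_differentiable_def intro: has_field_derivative_at_within)
  have "heun_local_solution (1 / 2) (of_nat ((2 * k + 1) * (k + n + 1)))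
            (of_nat (2 * (k + n + 1))) (of_nat (2 * k + 1))
            (of_nat (2 * k + 1)) (of_nat (2 * k + 1)) u"
    unfolding heun_local_solution_def Let_def
  proof (intro conjI)
    show "u analytic_on {0}" using hol S by (auto simp: analytic_at)
    show "u 0 = 1" by (simp add: u_def U1)
    have "\<forall>\<^sub>F z in at 0. z \<in> S \<and> z \<noteq> 0"
      using S by (intro eventually_conj eventually_at_in_open' eventually_neq_at_within)
        (auto simp: eventually_at_topological)
    then show "\<forall>\<^sub>F z in at 0. deriv (deriv u) z
       + (of_nat (2 * k + 1) / z + of_nat (2 * k + 1) / (z - 1)
          + (of_nat (2 * (k + n + 1)) + of_nat (2 * k + 1) + 1 - of_nat (2 * k + 1)
              - of_nat (2 * k + 1)) / (z - 1 / 2)) * deriv u z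
       + (of_nat (2 * (k + n + 1)) * of_nat (2 * k + 1) * z - of_nat ((2 * k + 1) * (k + n + 1)))
         / (z * (z - 1) * (z - 1 / 2)) * u z = 0"
    proof eventually_elim
      case (elim z)
      define y where "y = 1 - 2 * z"
      have zy: "z = (1 - y) / 2" by (simp add: y_def)
      have "z \<noteq> 1" using elim by (auto simp: S_def)
      then have y: "y \<noteq> 0" "y \<noteq> 1" "y \<noteq> -1"
        using elim ne[of z] by (auto simp: y_def)
      define N K where "N = (of_nat n :: complex)" and "K = (of_nat k :: complex)"
      define Z where "Z = (of_nat (2 * k + 1) / z + of_nat (2 * k + 1) / (z - 1)
          + (of_nat (2 * (k + n + 1)) + of_nat (2 * k + 1) + 1 - of_nat (2 * k + 1)
              - of_nat (2 * k + 1)) / (z - 1 / 2) :: complex)"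
      define W where "W = (of_nat (2 * (k + n + 1)) * of_nat (2 * k + 1) * z
           - of_nat ((2 * k + 1) * (k + n + 1))) / (z * (z - 1) * (z - 1 / 2))"
      have f: "y - 1 \<noteq> 0" "y + 1 \<noteq> 0" "1 - y \<noteq> 0" using y by (auto simp: eq_neg_iff_add_eq_0)
      have z1: "z - 1 = - (1 + y) / 2" "z - 1 / 2 = - y / 2" by (simp_all add: zy field_simps)
      have y2: "y^2 - 1 \<noteq> 0" using y by (simp add: power2_eq_1_iff)
      have Z: "- 2 * Z * (y * (y^2 - 1)) = 4 * (2 * (2 * K + 1) * y^2 + 2 * (N + 1) * (y^2 - 1))"
        unfolding Z_def z1 unfolding zy N_def K_def using f y
        by (simp add: divide_simps power2_eq_square) (simp add: algebra_simps)
      have W: "W * (y * (y^2 - 1)) = 4 * (2 * (2 * K + 1) * (K + N + 1) * y)"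
        unfolding W_def z1 unfolding zy N_def K_def using f y
        by (simp add: divide_simps power2_eq_square) (simp add: algebra_simps)
      have "(y * (y^2 - 1)) * (4 * U2 y + Z * (- 2 * U1 y) + W * U y)
         = 4 * (y * (y^2 - 1) * U2 y) + (- 2 * Z * (y * (y^2 - 1))) * U1 y + (W * (y * (y^2 - 1))) * U y"
        by (simp add: algebra_simps)
      also have "\<dots> = 4 * (y * (y^2 - 1) * U2 y
          + (2 * (2 * K + 1) * y^2 + 2 * (N + 1) * (y^2 - 1)) * U1 y
          + 2 * (2 * K + 1) * (K + N + 1) * y * U y)"
        unfolding Z W by (simp add: algebra_simps)
      also have "\<dots> = 0"
        using eq[OF y(1)] by (simp add: centred_heun_eq_def N_def K_def)
      finally have "4 * U2 y + Z * (- 2 * U1 y) + W * U y = 0"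
        using y2 y(1) by simp
      then show ?case
        using elim deriv1[of z] deriv2[of z] unfolding Z_def[symmetric] W_def[symmetric]
        by (simp add: u_def y_def)
    qed
  qed
  moreover have "(1 / 2 :: complex) \<noteq> 0" by simp
  ultimately have "Hl (1 / 2) (of_nat ((2 * k + 1) * (k + n + 1)))
            (of_nat (2 * (k + n + 1))) (of_nat (2 * k + 1))
            (of_nat (2 * k + 1)) (of_nat (2 * k + 1)) x = u x"
    using hol x of_nat_Suc_neq unfolding S_def by (intro Hl_eq_local_solution[where r = "1 / 2"])
  then show ?thesis by (simp add: u_def)
qed

section \<open>A solution in inverse powers of y\<close>

lemma half_plus_int_neq_0: "of_int i + 1 / 2 \<noteq> (0 :: complex)"
proof
  assume "of_int i + 1 / 2 = (0 :: complex)"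
  then have "of_int (2 * i + 1) = (0 :: complex)" by (simp add: field_simps)
  then have "2 * i + 1 = 0" unfolding of_int_eq_0_iff .
  then show False by presburger
qed

text \<open>
  The coefficients of the hypergeometric polynomial \<open>2F1 (k - n, k + 1/2; 1/2 - n; 1 / y\<^sup>2)\<close>; times
  \<open>y powi (- 2 k - 1)\<close> it solves the centred equation.
\<close>

definition inv_coeff :: "nat \<Rightarrow> nat \<Rightarrow> nat \<Rightarrow> complex" where
  "inv_coeff n k j = pochhammer (of_nat k + 1 / 2) j * pochhammer (- of_nat (n - k)) j
     / (fact j * pochhammer (1 / 2 - of_nat n) j)"

lemma pochhammer_half_neq_0: "pochhammer (of_nat k + 1 / 2) m \<noteq> (0 :: complex)"
proof
  assume "pochhammer (of_nat k + 1 / 2) m = (0 :: complex)"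
  then obtain i where "of_nat k + 1 / 2 = - (of_nat i :: complex)"
    by (auto simp: pochhammer_eq_0_iff)
  then show False
    using half_plus_int_neq_0[of "int k + int i"] by (simp add: eq_neg_iff_add_eq_0 algebra_simps)
qed

lemma half_minus_nat_neq: "1 / 2 - of_nat n \<noteq> - (of_nat i :: complex)"
  using half_plus_int_neq_0[of "int i - int n"] by (auto simp: eq_neg_iff_add_eq_0 algebra_simps)

lemma inv_coeff_Suc:
  assumes "k \<le> n"
  shows "inv_coeff n k (Suc j) * of_nat (Suc j) * (of_nat j + 1 / 2 - of_nat n)
    = (of_nat k + 1 / 2 + of_nat j) * (of_nat k + of_nat j - of_nat n) * inv_coeff n k j"
proof -
  have "pochhammer (1 / 2 - of_nat n) j \<noteq> (0 :: complex)"
    using half_minus_nat_neq by (auto simp: pochhammer_eq_0_iff)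
  moreover have "of_nat j + 1 / 2 - of_nat n \<noteq> (0 :: complex)"
    using half_minus_nat_neq[of n j] by (simp add: algebra_simps eq_neg_iff_add_eq_0)
  moreover have "(1 :: complex) + of_nat j \<noteq> 0"
    by (metis of_nat_Suc of_nat_neq_0)
  ultimately show ?thesis using assms unfolding inv_coeff_def pochhammer_Suc
    by (simp add: of_nat_diff divide_simps) (simp add: algebra_simps)
qed

lemma DERIV_power_int_div:
  fixes y :: complex
  assumes "y \<noteq> 0"
  shows "((\<lambda>y. y powi s) has_field_derivative of_int s * y powi s / y) (at y)"
  using assms by (auto intro!: derivative_eq_intros simp: power_int_diff)

text \<open>
  A series in descending powers, as for an expansion at \<open>y = \<infinity>\<close>. The centred operator maps \<open>y powi s\<close> to
  \<open>(s + 2 k + 1) (s + 2 k + 2 n + 2) y powi (s + 1) - s (s + 2 n + 1) y powi (s - 1)\<close>. The exponents go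
  down in steps of 2, so the second part of one term has the power of the first part of the next;
  the recurrence for the coefficients makes these cancel, and what is left at the two ends is 0.
\<close>

lemma inv_power_sum_solution:
  fixes k n :: nat
  assumes kn: "k \<le> n" and y: "y \<noteq> 0"
  defines "s \<equiv> \<lambda>j. - 2 * int k - 1 - 2 * int j"
  shows "centred_heun_eq k n y (\<Sum>j\<le>n - k. inv_coeff n k j * y powi s j)
     (\<Sum>j\<le>n - k. inv_coeff n k j * (of_int (s j) * y powi s j / y))
     (\<Sum>j\<le>n - k. inv_coeff n k j * (of_int (s j) * (of_int (s j) - 1) * y powi s j / y^2))"
proof -
  define N K where "N = (of_nat n :: complex)" and "K = (of_nat k :: complex)"
  define T where "T j = inv_coeff n k j * (- 2 * of_nat j) * (2 * N + 1 - 2 * of_nat j) * y powi (s j + 1)"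
    for j
  have sc: "of_int (s j) = - 2 * K - 1 - 2 * of_nat j" for j by (simp add: s_def K_def)
  have tele: "y * (y^2 - 1) * (inv_coeff n k j * (of_int (s j) * (of_int (s j) - 1) * y powi s j / y^2))
      + (2 * (2 * K + 1) * y^2 + 2 * (N + 1) * (y^2 - 1)) * (inv_coeff n k j * (of_int (s j) * y powi s j / y))
      + 2 * (2 * K + 1) * (K + N + 1) * y * (inv_coeff n k j * y powi s j) = T j - T (Suc j)" for j
  proof -
    have p: "y powi (s j + 1) = y powi s j * y" "y powi (s (Suc j) + 1) = y powi s j / y"
    proof -
      have e: "s (Suc j) + 1 = s j - 1" by (simp add: s_def)
      show "y powi (s j + 1) = y powi s j * y" "y powi (s (Suc j) + 1) = y powi s j / y"
        unfolding e using y by (simp_all add: power_int_add power_int_diff)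
    qed
    have "T (Suc j) = 4 * (inv_coeff n k (Suc j) * of_nat (Suc j) * (of_nat j + 1 / 2 - N)) * (y powi s j / y)"
      unfolding T_def p by (simp add: algebra_simps)
    also have "\<dots> = 4 * (K + 1 / 2 + of_nat j) * (K + of_nat j - N) * inv_coeff n k j * (y powi s j / y)"
      unfolding N_def K_def inv_coeff_Suc[OF kn] by (simp add: algebra_simps)
    finally have T: "T (Suc j) = \<dots>" .
    show ?thesis unfolding T unfolding T_def p sc using y
      by (simp add: divide_simps power2_eq_square) (simp add: algebra_simps)
  qed
  have "T (Suc (n - k)) = 0" unfolding T_def inv_coeff_def
    by (simp add: pochhammer_of_nat_eq_0_iff del: of_nat_Suc)
  moreover have "T 0 = 0" by (simp add: T_def)
  ultimately have "(\<Sum>j\<le>n - k. T j - T (Suc j)) = 0"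
    by (subst sum_telescope) simp
  then show ?thesis
    unfolding centred_heun_eq_def N_def[symmetric] K_def[symmetric] sum_distrib_left
      sum.distrib[symmetric] tele .
qed

section \<open>A solution in powers of 1 - y^2\<close>

lemma Suc_binomial_eq: "i \<le> N \<Longrightarrow> of_nat (Suc i) * of_nat (N choose Suc i)
   = of_nat (N - i) * (of_nat (N choose i) :: complex)"
  unfolding of_nat_mult[symmetric] by (simp only: binomial_absorb_comp binomial_absorption)

text \<open>
  The coefficients of \<open>2F1 (k - n, k + 1/2; 2 k + 1; z)\<close> in \<open>z = 1 - y\<^sup>2 = 4 x (1 - x)\<close>; the sign
  is absorbed in the theorem by expanding in \<open>x\<^sup>2 - x\<close>.
\<close>

definition hyp_coeff :: "nat \<Rightarrow> nat \<Rightarrow> nat \<Rightarrow> complex" where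
  "hyp_coeff n k j = (- 1) ^ j * of_nat ((n - k) choose j)
     * (pochhammer (of_nat k + 1 / 2) j / pochhammer (of_nat (2 * k + 1)) j)"

lemma hyp_coeff_Suc:
  assumes "k \<le> n"
  shows "hyp_coeff n k (Suc j) * of_nat (Suc j) * (of_nat j + 1 + 2 * of_nat k)
    = (of_nat j + of_nat k - of_nat n) * (of_nat j + of_nat k + 1 / 2) * hyp_coeff n k j"
proof -
  have p: "pochhammer (of_nat (2 * k + 1)) j \<noteq> (0 :: complex)"
    by (rule pochhammer_of_nat_Suc_neq_0)
  have q: "of_nat (2 * k + 1) + of_nat j \<noteq> (0 :: complex)"
    using of_nat_Suc_neq[of "2 * k" j] by (simp add: eq_neg_iff_add_eq_0)
  have "of_nat ((n - k) choose Suc j) * of_nat (Suc j)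
      = (of_nat n - of_nat k - of_nat j) * (of_nat ((n - k) choose j) :: complex)"
  proof (cases "j \<le> n - k")
    case True
    then show ?thesis
      using Suc_binomial_eq[OF True] assms by (simp add: of_nat_diff mult.commute del: of_nat_Suc)
  qed (simp add: binomial_eq_0)
  then have b: "of_nat ((n - k) choose Suc j) * (1 + of_nat j)
      = (of_nat n - of_nat k - of_nat j) * (of_nat ((n - k) choose j) :: complex)" by simp
  have "hyp_coeff n k (Suc j) * of_nat (Suc j) * (of_nat j + 1 + 2 * of_nat k)
    = - ((- 1) ^ j) * (of_nat ((n - k) choose Suc j) * (1 + of_nat j))
      * ((pochhammer (of_nat k + 1 / 2) j * (of_nat k + 1 / 2 + of_nat j))
          / pochhammer (of_nat (2 * k + 1)) j)"
    unfolding hyp_coeff_def pochhammer_Suc using p q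
    by (simp add: divide_simps del: binomial_Suc_Suc)
  also have "\<dots> = (of_nat j + of_nat k - of_nat n) * (of_nat j + of_nat k + 1 / 2) * hyp_coeff n k j"
    unfolding b hyp_coeff_def using p by (simp add: divide_simps) (simp add: algebra_simps)
  finally show ?thesis .
qed

text \<open>
  The number \<open>- 2 n - 1\<close> is the nonzero exponent of the singular point \<open>y = 0\<close>; therefore the terms
  with the power \<open>y powi (- 2 n - 2)\<close> that arise from the prefactor cancel. The centred operator maps
  \<open>y powi (- 2 n - 1) z ^ j\<close> to \<open>4 y powi (- 2 n)\<close> times
  \<open>(j + k - n) (j + k + 1/2) z ^ j - j (j + 2 k) z ^ (j - 1)\<close>, and the sum over \<open>j\<close> telescopes by the
  hypergeometric recurrence.
\<close>

lemma hyp_sum_solution: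
  fixes k n :: nat
  assumes kn: "k \<le> n" and y: "y \<noteq> 0"
  defines "p \<equiv> - 2 * int n - 1" and "z \<equiv> 1 - y^2"
  shows "centred_heun_eq k n y
     (\<Sum>j\<le>n - k. hyp_coeff n k j * (y powi p * z ^ j))
     (\<Sum>j\<le>n - k. hyp_coeff n k j *
        (y powi p * (of_int p / y * z ^ j - 2 * y * (of_nat j * z ^ (j - 1)))))
     (\<Sum>j\<le>n - k. hyp_coeff n k j *
        (y powi p * (of_int p * (of_int p - 1) / y^2 * z ^ j
           - 2 * (2 * of_int p + 1) * (of_nat j * z ^ (j - 1))
           + 4 * y^2 * (of_nat j * of_nat (j - 1) * z ^ (j - 2)))))"
proof -
  define N K where "N = (of_nat n :: complex)" and "K = (of_nat k :: complex)"
  define T where "T j = 4 * y * y powi p * (hyp_coeff n k j * (of_nat j + 2 * K) * (of_nat j * z ^ (j - 1)))"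
    for j
  have pc: "of_int p = - 2 * N - 1" by (simp add: p_def N_def)
  have tele: "y * (y^2 - 1) * (hyp_coeff n k j *
        (y powi p * (of_int p * (of_int p - 1) / y^2 * z ^ j
           - 2 * (2 * of_int p + 1) * (of_nat j * z ^ (j - 1))
           + 4 * y^2 * (of_nat j * of_nat (j - 1) * z ^ (j - 2)))))
      + (2 * (2 * K + 1) * y^2 + 2 * (N + 1) * (y^2 - 1)) * (hyp_coeff n k j *
        (y powi p * (of_int p / y * z ^ j - 2 * y * (of_nat j * z ^ (j - 1)))))
      + 2 * (2 * K + 1) * (K + N + 1) * y * (hyp_coeff n k j * (y powi p * z ^ j)) = T (Suc j) - T j" for j
  proof -
    define J Y where "J = (of_nat j :: complex)" and "Y = y powi p"
    define P0 P1 P2 where "P0 = z ^ j" and "P1 = of_nat j * z ^ (j - 1)"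
      and "P2 = of_nat j * of_nat (j - 1) * z ^ (j - 2)"
    define c where "c = hyp_coeff n k j"
    \<comment> \<open>All factors \<open>y\<^sup>2\<close> can be traded for \<open>z\<close>, after which these two rules lower the number of
      different powers of \<open>z\<close> to two; natural subtraction is harmless because of the factors \<open>j\<close>.\<close>
    have zP: "P1 * z = J * P0" "P2 * z = (J - 1) * P1"
      unfolding P0_def P1_def P2_def J_def by (cases j; cases "j - 1"; simp)+
    have y2: "y^2 = 1 - z" by (simp add: z_def)
    have "T (Suc j) = 4 * y * Y * (hyp_coeff n k (Suc j) * of_nat (Suc j) * (J + 1 + 2 * K)) * P0"
      unfolding T_def P0_def Y_def J_def by (simp add: algebra_simps)
    also have "\<dots> = 4 * y * Y * ((J + K - N) * (J + K + 1 / 2) * c) * P0"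
      unfolding N_def K_def J_def c_def hyp_coeff_Suc[OF kn] by simp
    finally have T: "T (Suc j) = \<dots>" .
    have T': "T j = 4 * y * Y * (c * (J + 2 * K) * P1)"
      unfolding T_def P1_def J_def c_def Y_def by simp
    have "y * (y^2 - 1) * (c * (Y * ((-2 * N - 1) * (-2 * N - 1 - 1) / y^2 * P0
           - 2 * (2 * (-2 * N - 1) + 1) * P1 + 4 * y^2 * P2)))
      + (2 * (2 * K + 1) * y^2 + 2 * (N + 1) * (y^2 - 1)) * (c *
        (Y * ((-2 * N - 1) / y * P0 - 2 * y * P1)))
      + 2 * (2 * K + 1) * (K + N + 1) * y * (c * (Y * P0))
     = c * Y * y * (- 2 * (2 * K + 1) * (2 * N + 1) * P0 + 2 * (2 * K + 1) * (K + N + 1) * P0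
        + 2 * (2 * (-2 * N - 1) + 1) * (P1 * z) - 4 * y^2 * (P2 * z)
        - 4 * (2 * K + 1) * y^2 * P1 + 4 * (N + 1) * (P1 * z))"
      unfolding y2[symmetric] z_def using y
      by (simp add: divide_simps) (simp add: algebra_simps power2_eq_square)
    also have "\<dots> = c * Y * y * (- 2 * (2 * K + 1) * (2 * N + 1) * P0 + 2 * (2 * K + 1) * (K + N + 1) * P0
        + 2 * (2 * (-2 * N - 1) + 1) * (J * P0) - 4 * ((J - 1) * (P1 - J * P0))
        - 4 * (2 * K + 1) * (P1 - J * P0) + 4 * (N + 1) * (J * P0))"
      unfolding zP y2 unfolding zP(1)[symmetric] by (simp add: algebra_simps)
    also have "\<dots> = T (Suc j) - T j"
      unfolding T T' by (simp add: field_simps)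
    finally show ?thesis unfolding pc P0_def P1_def P2_def Y_def c_def .
  qed
  have "T (Suc (n - k)) = 0" unfolding T_def hyp_coeff_def by (simp add: binomial_eq_0)
  moreover have "T 0 = 0" by (simp add: T_def)
  ultimately have "(\<Sum>j\<le>n - k. T (Suc j) - T j) = 0"
    using sum_telescope[of T "n - k"] by (simp add: sum_subtractf)
  then show ?thesis
    unfolding centred_heun_eq_def N_def[symmetric] K_def[symmetric] sum_distrib_left
      sum.distrib[symmetric] tele .
qed

section \<open>Normalization and binomial form of the first solution\<close>

text \<open>
  The Chu-Vandermonde identity gives the value of \<open>2F1 (k - n, k + 1/2; 1/2 - n; 1)\<close>, which is the
  value of the first solution at \<open>y = 1\<close>, that is at \<open>x = 0\<close>.
\<close>

lemma sum_inv_coeff: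
  assumes "k \<le> n"
  shows "(\<Sum>j\<le>n - k. inv_coeff n k j)
    = pochhammer (of_nat (2 * k + 1)) (n - k) / pochhammer (of_nat k + 1 / 2) (n - k)"
proof -
  define m where "m = n - k"
  have n: "n = k + m" using assms by (simp add: m_def)
  have "(\<Sum>j\<le>m. inv_coeff n k j)
     = pochhammer (1 / 2 - of_nat n - (of_nat k + 1 / 2)) m / pochhammer (1 / 2 - of_nat n) m"
    using Vandermonde_pochhammer[of m "1 / 2 - of_nat n" "of_nat k + 1 / 2 :: complex"] half_minus_nat_neq
    by (simp add: inv_coeff_def m_def atLeast0AtMost)
  also have "1 / 2 - of_nat n - (of_nat k + 1 / 2) = - (of_nat (n + k) :: complex)" by simp
  also have "pochhammer (- (of_nat (n + k) :: complex)) m = (- 1) ^ m * pochhammer (of_nat (2 * k + 1)) m"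
    unfolding pochhammer_minus by (simp add: n algebra_simps)
  also have "1 / 2 - of_nat n = - (of_nat n - 1 / 2 :: complex)" by simp
  also have "pochhammer (- (of_nat n - 1 / 2 :: complex)) m = (- 1) ^ m * pochhammer (of_nat k + 1 / 2) m"
    unfolding pochhammer_minus by (simp add: n algebra_simps)
  finally show ?thesis by (simp add: m_def)
qed

text \<open>
  The summand of the first formula of the theorem, without the constant in front of the sum.
\<close>

definition inv_binomial_coeff :: "nat \<Rightarrow> nat \<Rightarrow> nat \<Rightarrow> complex" where
  "inv_binomial_coeff n k j = of_nat ((2 * k + 2 * j) choose (2 * j)) * of_nat (n choose (k + j)) * of_real (r_coeff n j)"

lemma central_binomial_Suc:
  "of_nat (Suc p) * of_nat ((2 * Suc p) choose Suc p)
    = 2 * (2 * of_nat p + 1) * (of_nat ((2 * p) choose p) :: complex)"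
proof -
  have "(1 :: complex) + of_nat p \<noteq> 0"
    by (metis of_nat_Suc of_nat_neq_0)
  moreover have "2 * Suc p - Suc p = Suc p" "2 * p - p = p" by simp_all
  ultimately show ?thesis
    by (simp add: binomial_fact divide_simps del: binomial_Suc_Suc) (simp add: algebra_simps)
qed

lemma even_binomial_Suc:
  "of_nat ((2 * k + 2 * Suc j) choose (2 * Suc j)) * ((2 * of_nat j + 1) * (of_nat j + 1))
    = (2 * of_nat k + 2 * of_nat j + 1) * (of_nat k + of_nat j + 1)
        * (of_nat ((2 * k + 2 * j) choose (2 * j)) :: complex)"
proof -
  define J K where "J = (of_nat j :: complex)" and "K = (of_nat k :: complex)"
  have nz: "1 + J \<noteq> 0" "1 + 2 * J \<noteq> 0" "2 + 2 * J \<noteq> 0"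
    using of_nat_neq_0[of j, where 'a = complex] of_nat_neq_0[of "2 * j", where 'a = complex]
      of_nat_neq_0[of "Suc (2 * j)", where 'a = complex]
    by (simp_all add: add_ac J_def)
  show ?thesis
    using nz by (simp add: binomial_fact divide_simps del: binomial_Suc_Suc flip: J_def K_def)
      (simp add: algebra_simps)
qed

text \<open>
  The quotient of consecutive terms of \<open>inv_binomial_coeff\<close>, assembled from those of its five binomial
  factors \<open>B1\<close>, ..., \<open>B5\<close>, is the hypergeometric one. Here \<open>J\<close>, \<open>K\<close> are the indices \<open>j\<close>, \<open>k\<close>,
  \<open>n = K + J + I + 1\<close>, and \<open>q\<close> is the factor \<open>4 ^ (- n)\<close> of \<open>r_coeff\<close>.
\<close>

lemma inv_binomial_coeff_Suc_algebra:
  fixes B5 :: complex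
  assumes nz: "J + 1 \<noteq> 0" "2 * J + 1 \<noteq> 0" "K + J + 1 \<noteq> 0" "K + I + 1 \<noteq> 0" "2 * (K + I) + 1 \<noteq> 0"
    "B3 \<noteq> 0"
  shows "(2 * K + 2 * J + 1) * (K + J + 1) / ((2 * J + 1) * (J + 1)) * B1 *
     ((I + 1) / (K + J + 1) * B2)
    * (inverse ((K + I + 1) / (J + 1) * B3) * q * (2 * (2 * J + 1) / (J + 1) * B4)
      * ((K + I + 1) / (2 * (2 * (K + I) + 1)) * B5))
    * (J + 1) * (J + 1 / 2 - (K + J + I + 1))
   = (K + 1 / 2 + J) * (K + J - (K + J + I + 1)) * (B1 * B2 * (inverse B3 * q * B4 * B5))"
proof -
  define E F where "E = 2 * (K + I) + 1" and "F = 2 * J + 1"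
  have h: "J + 1 / 2 - (K + J + I + 1) = - E / 2" "K + 1 / 2 + J = (2 * K + 2 * J + 1) / 2"
    by (simp_all add: E_def field_simps)
  show ?thesis using nz unfolding h E_def[symmetric] F_def[symmetric]
    by (simp add: divide_simps) (simp add: algebra_simps)
qed
lemma inv_binomial_coeff_eq:
  assumes "k + j \<le> n"
  shows "inv_binomial_coeff n k j = of_nat (n choose k) / 4 ^ n * of_nat ((2 * n) choose n) * inv_coeff n k j"
  using assms
proof (induction j)
  case 0
  have "r_coeff n 0 = real ((2 * n) choose n) / 4 ^ n" by (simp add: r_coeff_def field_simps)
  then show ?case unfolding inv_binomial_coeff_def inv_coeff_def by simp
next
  case (Suc j)
  obtain i where n: "n = Suc (k + j + i)" using Suc.prems less_imp_Suc_add[of "k + j" n] by auto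
  have kn: "k \<le> n" using n by simp
  have "inv_binomial_coeff n k (Suc j) * of_nat (Suc j) * (of_nat j + 1 / 2 - of_nat n)
    = (of_nat k + 1 / 2 + of_nat j) * (of_nat k + of_nat j - of_nat n) * inv_binomial_coeff n k j"
  proof -
    define J K I N where "J = (of_nat j :: complex)" and "K = (of_nat k :: complex)"
      and "I = (of_nat i :: complex)" and "N = (of_nat n :: complex)"
    have N: "N = K + J + I + 1" by (simp add: N_def n J_def K_def I_def)
    have nz: "J + 1 \<noteq> 0" "2 * J + 1 \<noteq> 0" "K + J + 1 \<noteq> 0" "K + I + 1 \<noteq> 0" "2 * (K + I) + 1 \<noteq> 0"
      unfolding J_def K_def I_def
      using of_nat_neq_0[of j, where 'a = complex] of_nat_neq_0[of "2 * j", where 'a = complex]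
        of_nat_neq_0[of "k + j", where 'a = complex] of_nat_neq_0[of "k + i", where 'a = complex]
        of_nat_neq_0[of "2 * (k + i)", where 'a = complex]
      by (simp_all add: add_ac distrib_left)
    have b1: "of_nat ((2 * k + 2 * Suc j) choose (2 * Suc j))
        = (2 * K + 2 * J + 1) * (K + J + 1) / ((2 * J + 1) * (J + 1))
            * (of_nat ((2 * k + 2 * j) choose (2 * j)) :: complex)"
      using even_binomial_Suc[of k j] nz unfolding J_def K_def
      by (simp only: times_divide_eq_left nonzero_eq_divide_eq mult_eq_0_iff simp_thms)
    have b2: "of_nat (n choose (k + Suc j)) = (I + 1) / (K + J + 1) * (of_nat (n choose (k + j)) :: complex)"
      using Suc_binomial_eq[of "k + j" n] nz by (simp add: n field_simps J_def K_def I_def del: binomial_Suc_Suc)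
    have b3: "of_nat (n choose Suc j) = (K + I + 1) / (J + 1) * (of_nat (n choose j) :: complex)"
      using Suc_binomial_eq[of j n] nz by (simp add: n field_simps J_def K_def I_def del: binomial_Suc_Suc)
    have b4: "of_nat ((2 * Suc j) choose Suc j) = 2 * (2 * J + 1) / (J + 1) * (of_nat ((2 * j) choose j) :: complex)"
      using central_binomial_Suc[of j] nz by (simp add: J_def divide_simps mult_ac add_ac del: binomial_Suc_Suc)
    have e: "2 * n - 2 * j = 2 * Suc (k + i)" "n - j = Suc (k + i)"
       "2 * n - 2 * Suc j = 2 * (k + i)" "n - Suc j = k + i" by (simp_all add: n)
    have b5: "of_nat ((2 * (k + i)) choose (k + i)) = (K + I + 1) / (2 * (2 * (K + I) + 1)) * (of_nat ((2 * Suc (k + i)) choose Suc (k + i)) :: complex)"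
    proof -
      have "of_nat ((2 * (k + i)) choose (k + i)) * (2 * (2 * (K + I) + 1))
          = (K + I + 1) * (of_nat ((2 * Suc (k + i)) choose Suc (k + i)) :: complex)"
        using central_binomial_Suc[of "k + i"] unfolding K_def I_def
        by (simp only: of_nat_Suc of_nat_add ac_simps)
      moreover have "2 * (2 * (K + I) + 1) \<noteq> 0"
        by (rule no_zero_divisors[OF _ nz(5)]) simp
      ultimately show ?thesis by (simp only: times_divide_eq_left nonzero_eq_divide_eq simp_thms)
    qed
    have b3nz: "(of_nat (n choose j) :: complex) \<noteq> 0" by (simp add: n)
    show ?thesis
      unfolding inv_binomial_coeff_def r_coeff_def of_real_mult of_real_inverse of_real_of_nat_eq e
        b1 b2 b3 b4 b5 of_nat_Suc
      unfolding J_def[symmetric] K_def[symmetric] N_def[symmetric]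
      unfolding N using inv_binomial_coeff_Suc_algebra[OF nz b3nz] by (simp add: add.commute)
  qed
  also have "\<dots> = of_nat (n choose k) / 4 ^ n * of_nat ((2 * n) choose n)
      * (inv_coeff n k (Suc j) * of_nat (Suc j) * (of_nat j + 1 / 2 - of_nat n))"
    unfolding inv_coeff_Suc[OF kn] using Suc by simp
  finally have "inv_binomial_coeff n k (Suc j) * (of_nat (Suc j) * (of_nat j + 1 / 2 - of_nat n))
      = of_nat (n choose k) / 4 ^ n * of_nat ((2 * n) choose n) * inv_coeff n k (Suc j)
        * (of_nat (Suc j) * (of_nat j + 1 / 2 - of_nat n))"
    by (simp only: mult.assoc)
  moreover have "of_nat j + 1 / 2 - of_nat n \<noteq> (0 :: complex)"
    using half_minus_nat_neq[of n j] by (simp add: algebra_simps eq_neg_iff_add_eq_0)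
  then have "of_nat (Suc j) * (of_nat j + 1 / 2 - of_nat n) \<noteq> (0 :: complex)"
    by (rule no_zero_divisors[OF of_nat_neq_0])
  ultimately show ?case by (simp only: mult_right_cancel not_False_eq_True)
qed

text \<open>
  The constant of the theorem turns the first solution into one with value 1 at \<open>x = 0\<close>: by the
  duplication formula for \<open>fact (2 * n)\<close> and \<open>fact (2 * k)\<close> everything reduces to
  \<open>(1/2)\<^sub>n = (1/2)\<^sub>k (k + 1/2)\<^sub>m\<close> and \<open>(n + k)! = (2 k)! (2 k + 1)\<^sub>m\<close> with \<open>m = n - k\<close>.
\<close>

lemma inv_binomial_coeff_normalization:
  assumes "k \<le> n"
  shows "4 ^ k * inverse (of_nat ((n + k) choose n)) * inverse (of_nat (n choose k))
    * (of_nat (n choose k) / 4 ^ n * of_nat ((2 * n) choose n))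
    * pochhammer (of_nat (2 * k + 1)) (n - k) / pochhammer (of_nat k + 1 / 2) (n - k) = (1 :: complex)"
proof -
  define m where "m = n - k"
  have n: "n = k + m" using assms by (simp add: m_def)
  have nk: "n + k = 2 * k + m" by (simp add: n)
  have "fact (n + k) = (fact (2 * k) * pochhammer (of_nat (2 * k + 1)) m :: complex)"
    using pochhammer_product'[of "1 :: complex" "2 * k" m] unfolding nk
    by (simp only: pochhammer_fact of_nat_add of_nat_1 add.commute)
  moreover have "pochhammer (1 / 2) n = (pochhammer (1 / 2) k * pochhammer (of_nat k + 1 / 2) m :: complex)"
    using pochhammer_product'[of "1 / 2 :: complex" k m] unfolding n by (simp only: add.commute)
  moreover have "pochhammer (1 / 2) k \<noteq> (0 :: complex)"
      "pochhammer (of_nat k + 1 / 2) m \<noteq> (0 :: complex)"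
    using pochhammer_half_neq_0[of 0] pochhammer_half_neq_0 by simp_all
  ultimately have q: "pochhammer (1 / 2) n = (pochhammer (1 / 2) k * pochhammer (of_nat k + 1 / 2) m :: complex)"
    and fnk: "fact (n + k) = (fact (2 * k) * pochhammer (of_nat (2 * k + 1)) m :: complex)"
    and nz: "pochhammer (1 / 2) k \<noteq> (0 :: complex)" "pochhammer (of_nat k + 1 / 2) m \<noteq> (0 :: complex)"
    by blast+
  have P: "pochhammer (of_nat (2 * k + 1)) m \<noteq> (0 :: complex)"
    using fnk by (metis fact_nonzero mult_zero_right)
  have c1: "of_nat ((2 * n) choose n) = (4 ^ n * pochhammer (1 / 2) n / fact n :: complex)"
    by (simp add: binomial_fact fact_double power_mult)
  have c2: "of_nat ((n + k) choose n)
      = (4 ^ k * pochhammer (1 / 2) k * pochhammer (of_nat (2 * k + 1)) m / fact n :: complex)"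
    by (simp add: binomial_fact fnk fact_double power_mult del: of_nat_Suc)
  have c3: "of_nat (n choose k) \<noteq> (0 :: complex)" using assms by simp
  show ?thesis
    unfolding c1 c2 q m_def[symmetric] using nz P c3 by (simp add: divide_simps)
qed

section \<open>The two closed forms\<close>

lemma DERIV_power_int_div2:
  fixes y :: complex
  assumes "y \<noteq> 0"
  shows "((\<lambda>y. of_int s * y powi s / y) has_field_derivative
     of_int s * (of_int s - 1) * y powi s / y^2) (at y)"
  by (rule DERIV_cong[OF DERIV_divide[OF DERIV_cmult[OF DERIV_power_int_div[OF assms]] DERIV_ident assms]])
    (use assms in \<open>simp add: field_simps power2_eq_square\<close>)

lemma Hl_half_inv_power_sum:
  assumes kn: "k \<le> n" and x: "norm x < 1 / 2"
  shows "Hl (1 / 2) (of_nat ((2 * k + 1) * (k + n + 1)))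
            (of_nat (2 * (k + n + 1))) (of_nat (2 * k + 1))
            (of_nat (2 * k + 1)) (of_nat (2 * k + 1)) x
    = pochhammer (of_nat k + 1 / 2) (n - k) / pochhammer (of_nat (2 * k + 1)) (n - k)
      * (\<Sum>j\<le>n - k. inv_coeff n k j * (1 - 2 * x) powi (- 2 * int k - 1 - 2 * int j))"
proof -
  define C where "C = (pochhammer (of_nat k + 1 / 2) (n - k) / pochhammer (of_nat (2 * k + 1)) (n - k) :: complex)"
  define s where "s j = - 2 * int k - 1 - 2 * int j" for j
  have C: "C * (\<Sum>j\<le>n - k. inv_coeff n k j) = 1"
    using pochhammer_half_neq_0[of k] pochhammer_of_nat_Suc_neq_0[of "2 * k"]
    by (simp add: sum_inv_coeff[OF kn] C_def del: of_nat_Suc)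
  show ?thesis unfolding C_def[symmetric] s_def[symmetric]
  proof (rule Hl_half_eqI[OF _ _ _ _ x])
    fix y :: complex assume y: "y \<noteq> 0"
    show "((\<lambda>y. C * (\<Sum>j\<le>n - k. inv_coeff n k j * y powi s j)) has_field_derivative
      C * (\<Sum>j\<le>n - k. inv_coeff n k j * (of_int (s j) * y powi s j / y))) (at y)"
      by (intro DERIV_cmult DERIV_sum DERIV_power_int_div y)
    show "((\<lambda>y. C * (\<Sum>j\<le>n - k. inv_coeff n k j * (of_int (s j) * y powi s j / y)))
      has_field_derivative C * (\<Sum>j\<le>n - k. inv_coeff n k j *
        (of_int (s j) * (of_int (s j) - 1) * y powi s j / y^2))) (at y)"
      by (intro DERIV_cmult DERIV_sum DERIV_power_int_div2 y)
    show "centred_heun_eq k n y (C * (\<Sum>j\<le>n - k. inv_coeff n k j * y powi s j))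
      (C * (\<Sum>j\<le>n - k. inv_coeff n k j * (of_int (s j) * y powi s j / y)))
      (C * (\<Sum>j\<le>n - k. inv_coeff n k j * (of_int (s j) * (of_int (s j) - 1) * y powi s j / y^2)))"
      unfolding s_def by (intro centred_heun_eq_scale inv_power_sum_solution kn y)
  qed (simp add: C)
qed

lemma DERIV_one_minus_square_power:
  fixes y :: complex
  shows "((\<lambda>y. (1 - y^2) ^ i) has_field_derivative - 2 * y * (of_nat i * (1 - y^2) ^ (i - 1))) (at y)"
  by (auto intro!: derivative_eq_intros)

lemma DERIV_powi_times_power:
  fixes y :: complex
  assumes "y \<noteq> 0"
  shows "((\<lambda>y. y powi p * (1 - y^2) ^ j) has_field_derivative
       y powi p * (of_int p / y * (1 - y^2) ^ j - 2 * y * (of_nat j * (1 - y^2) ^ (j - 1)))) (at y)"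
  by (rule DERIV_cong[OF DERIV_mult[OF DERIV_power_int_div[OF assms] DERIV_one_minus_square_power]])
    (simp add: algebra_simps)

lemma DERIV_powi_times_power2:
  fixes y :: complex
  assumes y: "y \<noteq> 0"
  shows "((\<lambda>y. y powi p * (of_int p / y * (1 - y^2) ^ j - 2 * y * (of_nat j * (1 - y^2) ^ (j - 1))))
      has_field_derivative y powi p * (of_int p * (of_int p - 1) / y^2 * (1 - y^2) ^ j
           - 2 * (2 * of_int p + 1) * (of_nat j * (1 - y^2) ^ (j - 1))
           + 4 * y^2 * (of_nat j * of_nat (j - 1) * (1 - y^2) ^ (j - 2)))) (at y)"
proof -
  define P0 P1 P2 where "P0 = (1 - y^2) ^ j" and "P1 = of_nat j * (1 - y^2) ^ (j - 1)"
    and "P2 = of_nat j * of_nat (j - 1) * (1 - y^2) ^ (j - 2)"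
  have d0: "((\<lambda>y. (1 - y^2) ^ j) has_field_derivative - 2 * y * P1) (at y)"
    unfolding P1_def by (rule DERIV_one_minus_square_power)
  have "j - 1 - 1 = j - 2" by simp
  then have d1: "((\<lambda>y. of_nat j * (1 - y^2) ^ (j - 1)) has_field_derivative - 2 * y * P2) (at y)"
    using DERIV_cmult[OF DERIV_one_minus_square_power[of "j - 1" y], of "of_nat j"]
    unfolding P2_def by (simp only: mult_ac)
  have i: "((\<lambda>y. of_int p / y) has_field_derivative - of_int p / y^2) (at y)"
    using y by (auto intro!: derivative_eq_intros simp: power2_eq_square)
  have l: "((\<lambda>y. 2 * y) has_field_derivative 2) (at y)"
    by (auto intro!: derivative_eq_intros)
  have alg: "of_int p * Y / y * (of_int p / y * P0 - 2 * y * P1)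
      + (- of_int p / y^2 * P0 + - 2 * y * P1 * (of_int p / y) - (2 * P1 + - 2 * y * P2 * (2 * y))) * Y
    = Y * (of_int p * (of_int p - 1) / y^2 * P0 - 2 * (2 * of_int p + 1) * P1 + 4 * y^2 * P2)" for Y
    using y by (simp add: divide_simps power2_eq_square) (simp add: algebra_simps)
  show ?thesis
    by (rule DERIV_cong[OF DERIV_mult[OF DERIV_power_int_div[OF y]
            DERIV_diff[OF DERIV_mult[OF i d0] DERIV_mult[OF l d1]]]])
      (simp only: alg flip: P0_def P1_def P2_def)
qed

lemma Hl_half_hyp_sum:
  assumes kn: "k \<le> n" and x: "norm x < 1 / 2"
  shows "Hl (1 / 2) (of_nat ((2 * k + 1) * (k + n + 1)))
            (of_nat (2 * (k + n + 1))) (of_nat (2 * k + 1))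
            (of_nat (2 * k + 1)) (of_nat (2 * k + 1)) x
    = (\<Sum>j\<le>n - k. hyp_coeff n k j * ((1 - 2 * x) powi (- 2 * int n - 1) * (1 - (1 - 2 * x)^2) ^ j))"
proof (rule Hl_half_eqI[OF _ _ _ _ x])
  fix y :: complex assume y: "y \<noteq> 0"
  define p where "p = - 2 * int n - 1"
  show "((\<lambda>y. \<Sum>j\<le>n - k. hyp_coeff n k j * (y powi (- 2 * int n - 1) * (1 - y^2) ^ j))
    has_field_derivative (\<Sum>j\<le>n - k. hyp_coeff n k j * (y powi (- 2 * int n - 1) *
      (of_int (- 2 * int n - 1) / y * (1 - y^2) ^ j - 2 * y * (of_nat j * (1 - y^2) ^ (j - 1)))))) (at y)"
    unfolding p_def[symmetric]
  proof (intro DERIV_sum DERIV_cmult)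
    fix j :: nat
    show "((\<lambda>y. y powi p * (1 - y^2) ^ j) has_field_derivative
       y powi p * (of_int p / y * (1 - y^2) ^ j - 2 * y * (of_nat j * (1 - y^2) ^ (j - 1)))) (at y)"
      by (rule DERIV_powi_times_power) (rule y)
  qed
  show "((\<lambda>y. \<Sum>j\<le>n - k. hyp_coeff n k j * (y powi (- 2 * int n - 1) *
      (of_int (- 2 * int n - 1) / y * (1 - y^2) ^ j - 2 * y * (of_nat j * (1 - y^2) ^ (j - 1)))))
    has_field_derivative (\<Sum>j\<le>n - k. hyp_coeff n k j * (y powi (- 2 * int n - 1) *
      (of_int (- 2 * int n - 1) * (of_int (- 2 * int n - 1) - 1) / y^2 * (1 - y^2) ^ j
           - 2 * (2 * of_int (- 2 * int n - 1) + 1) * (of_nat j * (1 - y^2) ^ (j - 1))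
           + 4 * y^2 * (of_nat j * of_nat (j - 1) * (1 - y^2) ^ (j - 2)))))) (at y)"
    unfolding p_def[symmetric]
  proof (intro DERIV_sum DERIV_cmult)
    fix j :: nat
    show "((\<lambda>y. y powi p * (of_int p / y * (1 - y^2) ^ j - 2 * y * (of_nat j * (1 - y^2) ^ (j - 1))))
      has_field_derivative y powi p * (of_int p * (of_int p - 1) / y^2 * (1 - y^2) ^ j
           - 2 * (2 * of_int p + 1) * (of_nat j * (1 - y^2) ^ (j - 1))
           + 4 * y^2 * (of_nat j * of_nat (j - 1) * (1 - y^2) ^ (j - 2)))) (at y)"
      by (rule DERIV_powi_times_power2) (rule y)
  qed
  show "centred_heun_eq k n y
     (\<Sum>j\<le>n - k. hyp_coeff n k j * (y powi (- 2 * int n - 1) * (1 - y^2) ^ j))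
     (\<Sum>j\<le>n - k. hyp_coeff n k j * (y powi (- 2 * int n - 1) *
      (of_int (- 2 * int n - 1) / y * (1 - y^2) ^ j - 2 * y * (of_nat j * (1 - y^2) ^ (j - 1)))))
     (\<Sum>j\<le>n - k. hyp_coeff n k j * (y powi (- 2 * int n - 1) *
      (of_int (- 2 * int n - 1) * (of_int (- 2 * int n - 1) - 1) / y^2 * (1 - y^2) ^ j
           - 2 * (2 * of_int (- 2 * int n - 1) + 1) * (of_nat j * (1 - y^2) ^ (j - 1))
           + 4 * y^2 * (of_nat j * of_nat (j - 1) * (1 - y^2) ^ (j - 2)))))"
    by (rule hyp_sum_solution[OF kn y])
next
  show "(\<Sum>j\<le>n - k. hyp_coeff n k j * (1 powi (- 2 * int n - 1) * (1 - 1^2) ^ j)) = 1"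
    by (simp add: power_0_left if_distrib cong: if_cong) (simp add: hyp_coeff_def)
qed

theorem mainTheorem12:
  fixes k n :: nat and x :: complex
  assumes "k \<le> n" and "norm x < 1 / 2"
  shows "Hl (1 / 2) (of_nat ((2 * k + 1) * (k + n + 1)))
            (of_nat (2 * (k + n + 1))) (of_nat (2 * k + 1))
            (of_nat (2 * k + 1)) (of_nat (2 * k + 1)) x
         = 4 ^ k * inverse (of_nat ((n + k) choose n)) * inverse (of_nat (n choose k))
           * (\<Sum>j = 0..n - k. of_nat ((2 * k + 2 * j) choose (2 * j)) * of_nat (n choose (k + j))
                * of_real (r_coeff n j) * (1 - 2 * x) powi (- 2 * int k - 1 - 2 * int j))
       \<and> Hl (1 / 2) (of_nat ((2 * k + 1) * (k + n + 1)))
            (of_nat (2 * (k + n + 1))) (of_nat (2 * k + 1))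
            (of_nat (2 * k + 1)) (of_nat (2 * k + 1)) x
         = (1 - 2 * x) powi (- 2 * int n - 1)
           * (\<Sum>j = 0..n - k. 4 ^ j * of_nat ((n - k) choose j)
                * (pochhammer (of_nat k + 1 / 2) j / pochhammer (of_nat (2 * k + 1)) j)
                * (x ^ 2 - x) ^ j)"
proof
  define A B :: complex where
    "A = 4 ^ k * inverse (of_nat ((n + k) choose n)) * inverse (of_nat (n choose k))"
    and "B = of_nat (n choose k) / 4 ^ n * of_nat ((2 * n) choose n)"
  have AB: "pochhammer (of_nat k + 1 / 2) (n - k) / pochhammer (of_nat (2 * k + 1)) (n - k) = A * B"
    using inv_binomial_coeff_normalization[OF assms(1)] pochhammer_half_neq_0[of k "n - k"]
      pochhammer_of_nat_Suc_neq_0[of "2 * k" "n - k"]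
    unfolding A_def[symmetric] B_def[symmetric] by (simp add: divide_simps del: of_nat_Suc)
  have "A * (\<Sum>j = 0..n - k. inv_binomial_coeff n k j * (1 - 2 * x) powi (- 2 * int k - 1 - 2 * int j))
      = A * (\<Sum>j\<le>n - k. B * (inv_coeff n k j * (1 - 2 * x) powi (- 2 * int k - 1 - 2 * int j)))"
    unfolding atLeast0AtMost using assms(1)
    by (intro arg_cong[where f = "(*) A"] sum.cong) (simp_all add: inv_binomial_coeff_eq B_def)
  then show "Hl (1 / 2) (of_nat ((2 * k + 1) * (k + n + 1)))
            (of_nat (2 * (k + n + 1))) (of_nat (2 * k + 1))
            (of_nat (2 * k + 1)) (of_nat (2 * k + 1)) x
         = 4 ^ k * inverse (of_nat ((n + k) choose n)) * inverse (of_nat (n choose k))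
           * (\<Sum>j = 0..n - k. of_nat ((2 * k + 2 * j) choose (2 * j)) * of_nat (n choose (k + j))
                * of_real (r_coeff n j) * (1 - 2 * x) powi (- 2 * int k - 1 - 2 * int j))"
    unfolding Hl_half_inv_power_sum[OF assms] AB A_def[symmetric] inv_binomial_coeff_def
    by (simp add: sum_distrib_left mult_ac)
  have z: "1 - (1 - 2 * x)^2 = (- 1) * (4 * (x^2 - x))"
    by (simp add: power2_eq_square algebra_simps)
  have "hyp_coeff n k j * (Y * (1 - (1 - 2 * x)^2) ^ j)
      = Y * (4 ^ j * of_nat ((n - k) choose j)
                * (pochhammer (of_nat k + 1 / 2) j / pochhammer (of_nat (2 * k + 1)) j)
                * (x ^ 2 - x) ^ j)" for j Y
  proof -
    have s: "(- 1) ^ j * (- 1) ^ j = (1 :: complex)" by (simp flip: power_mult_distrib)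
    have "hyp_coeff n k j * (Y * (1 - (1 - 2 * x)^2) ^ j) = ((- 1) ^ j * (- 1) ^ j)
      * (Y * (4 ^ j * of_nat ((n - k) choose j)
                * (pochhammer (of_nat k + 1 / 2) j / pochhammer (of_nat (2 * k + 1)) j)
                * (x ^ 2 - x) ^ j))"
      unfolding hyp_coeff_def z power_mult_distrib by (simp only: mult_ac)
    then show ?thesis unfolding s by simp
  qed
  then show "Hl (1 / 2) (of_nat ((2 * k + 1) * (k + n + 1)))
            (of_nat (2 * (k + n + 1))) (of_nat (2 * k + 1))
            (of_nat (2 * k + 1)) (of_nat (2 * k + 1)) x
         = (1 - 2 * x) powi (- 2 * int n - 1)
           * (\<Sum>j = 0..n - k. 4 ^ j * of_nat ((n - k) choose j)
                * (pochhammer (of_nat k + 1 / 2) j / pochhammer (of_nat (2 * k + 1)) j)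
                * (x ^ 2 - x) ^ j)"
    unfolding Hl_half_hyp_sum[OF assms] by (simp only: sum_distrib_left atLeast0AtMost)
qed

end
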